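(* Let $n\ge 2$. Then \[ o_V(\Gamma_n,1) = F_{\lfloor \frac{n-(-1)^n}{2}\rfloor + 2},\quad o_V(\Gamma_n,2) = \frac12\left(F_{n+2} - F_{\lfloor \frac{n-(-1)^n}{2}\rfloor + 2}\right),\quad o_V(\Gamma_n) = \frac12\left(F_{n+2} + F_{\lfloor \frac{n-(-1)^n}{2}\rfloor + 2}\right). \]
   Context: The Fibonacci cube $\Gamma_n$ is the subgraph of the $n$-cube $Q_n$ (binary strings of length $n$, adjacent iff they differ in exactly one position) induced by the binary strings of length $n$ with no two consecutive 1s. For a graph $G$, $o_V(G)$ is the number of orbits of ${\rm Aut}(G)$ acting on $V(G)$ and $o_V(G,k)$ is the number of such orbits of size $k$. $F_m$ are Fibonacci numbers with $F_0=0$, $F_1=1$. *)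

theory Defs
  imports
    "HOL-Algebra.Group_Action"
    "HOL-Number_Theory.Fib"
    "Graph_Theory.Digraph_Component"
begin

text \<open>
  Undirected graphs are symmetric digraphs, as in the locale \<open>graph\<close> of \<open>Graph_Theory\<close>;
  binary strings are Boolean lists, with \<open>True\<close> for 1.
\<close>

definition hypercube :: "nat \<Rightarrow> (bool list, bool list \<times> bool list) pre_digraph" where
  "hypercube n = with_proj
     \<lparr> pverts = {u. length u = n},
       parcs = {(u, v). length u = n \<and> length v = n \<and> card {i. i < n \<and> u ! i \<noteq> v ! i} = 1} \<rparr>"

definition fibonacci_string :: "bool list \<Rightarrow> bool" where
  "fibonacci_string u \<longleftrightarrow> (\<forall>i. Suc i < length u \<longrightarrow> \<not> (u ! i \<and> u ! Suc i))"

definition fibonacci_cube :: "nat \<Rightarrow> (bool list, bool list \<times> bool list) pre_digraph" where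
  "fibonacci_cube n = hypercube n \<restriction> {u. length u = n \<and> fibonacci_string u}"

text \<open>
  Automorphisms are vertex permutations preserving adjacency and non-adjacency, which is the
  right notion for graphs without parallel edges. As elements of \<^const>\<open>Bij\<close> they are
  extensional, so each one is represented by exactly one function.
\<close>

definition graph_automorphisms :: "('a, 'b) pre_digraph \<Rightarrow> ('a \<Rightarrow> 'a) set" where
  "graph_automorphisms G =
     {f \<in> Bij (verts G). \<forall>u \<in> verts G. \<forall>v \<in> verts G. u \<rightarrow>\<^bsub>G\<^esub> v \<longleftrightarrow> f u \<rightarrow>\<^bsub>G\<^esub> f v}"

definition automorphism_group :: "('a, 'b) pre_digraph \<Rightarrow> ('a \<Rightarrow> 'a) monoid" where
  "automorphism_group G = BijGroup (verts G) \<lparr>carrier := graph_automorphisms G\<rparr>"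

definition vertex_orbits :: "('a, 'b) pre_digraph \<Rightarrow> 'a set set" where
  "vertex_orbits G = orbits (automorphism_group G) (verts G) (\<lambda>f. f)"

definition num_vertex_orbits :: "('a, 'b) pre_digraph \<Rightarrow> nat" where
  "num_vertex_orbits G = card (vertex_orbits G)"

definition num_vertex_orbits_of_size :: "('a, 'b) pre_digraph \<Rightarrow> nat \<Rightarrow> nat" where
  "num_vertex_orbits_of_size G k = card {X \<in> vertex_orbits G. card X = k}"

lemma graph_hypercube: "graph (hypercube n)"
proof -
  have fin: "finite {u :: bool list. length u = n}"
    using finite_lists_length_eq[of "UNIV :: bool set" n] by simp
  have sub: "{(u, v). length u = n \<and> length v = n \<and> card {i. i < n \<and> u ! i \<noteq> v ! i} = 1}
      \<subseteq> {u :: bool list. length u = n} \<times> {u. length u = n}"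
    by auto
  show ?thesis
  proof unfold_locales
    show "finite (arcs (hypercube n))"
      using finite_subset[OF sub] fin by (simp add: hypercube_def)
    have "{i. i < n \<and> u ! i \<noteq> v ! i} = {i. i < n \<and> v ! i \<noteq> u ! i}" for u v :: "bool list"
      by blast
    then have "card {i. i < n \<and> u ! i \<noteq> v ! i} = card {i. i < n \<and> v ! i \<noteq> u ! i}"
      for u v :: "bool list"
      by (rule arg_cong)
    then show "symmetric (hypercube n)"
      unfolding symmetric_def hypercube_def with_proj_simps pair_pre_digraph.simps sym_def mem_Collect_eq
        prod.case
      by metis
    show "finite (verts (hypercube n))"
      using fin by (simp add: hypercube_def)
    show "tail (hypercube n) e \<in> verts (hypercube n)" "head (hypercube n) e \<in> verts (hypercube n)"
      "tail (hypercube n) e \<noteq> head (hypercube n) e" if "e \<in> arcs (hypercube n)" for e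
    proof -
      obtain u v where e: "e = (u, v)" "length u = n" "length v = n"
          "card {i. i < n \<and> u ! i \<noteq> v ! i} = 1"
        using \<open>e \<in> arcs (hypercube n)\<close>
        unfolding hypercube_def with_proj_simps pair_pre_digraph.simps by blast
      then have "u \<noteq> v"
        by force
      with e show "tail (hypercube n) e \<in> verts (hypercube n)"
          "head (hypercube n) e \<in> verts (hypercube n)"
          "tail (hypercube n) e \<noteq> head (hypercube n) e"
        by (simp_all add: hypercube_def)
    qed
    show "e = e'" if "arc_to_ends (hypercube n) e = arc_to_ends (hypercube n) e'" for e e'
      using that by (simp add: hypercube_def arc_to_ends_def prod_eq_iff)
  qed
qed

lemma induced_subgraph_fibonacci_cube: "induced_subgraph (fibonacci_cube n) (hypercube n)"
proof -
  interpret graph "hypercube n" by (rule graph_hypercube)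
  show ?thesis
    unfolding fibonacci_cube_def by (rule induced_induce) (auto simp: hypercube_def)
qed

lemma graph_fibonacci_cube: "graph (fibonacci_cube n)"
proof -
  interpret graph "hypercube n" by (rule graph_hypercube)
  show ?thesis
    using induced_subgraph_fibonacci_cube
    by (intro graph.intro pseudo_graph.intro digraphI_induced induced_graph_imp_graph
        digraph.axioms(1))
qed

lemma subgroup_graph_automorphisms:
  "subgroup (graph_automorphisms G) (BijGroup (verts G))"
proof (rule group.subgroupI[OF group_BijGroup])
  show "graph_automorphisms G \<subseteq> carrier (BijGroup (verts G))"
    by (auto simp: graph_automorphisms_def BijGroup_def)
  have "(\<lambda>x\<in>verts G. x) \<in> graph_automorphisms G"
    by (simp add: graph_automorphisms_def id_Bij)
  then show "graph_automorphisms G \<noteq> {}"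
    by blast
next
  fix f assume f: "f \<in> graph_automorphisms G"
  then have fB: "f \<in> Bij (verts G)"
    by (simp add: graph_automorphisms_def)
  then have "f (inv_into (verts G) f x) = x" if "x \<in> verts G" for x
    using that by (auto simp: Bij_def bij_betw_def f_inv_into_f)
  then show "inv\<^bsub>BijGroup (verts G)\<^esub> f \<in> graph_automorphisms G"
    using f by (simp add: inv_BijGroup[OF fB] graph_automorphisms_def Bij_inv_into_mem[OF fB]
        restrict_inv_into_Bij[OF fB])
next
  fix f g assume fg: "f \<in> graph_automorphisms G" "g \<in> graph_automorphisms G"
  then have B: "f \<in> Bij (verts G)" "g \<in> Bij (verts G)"
    and "f \<in> verts G \<rightarrow> verts G" "g \<in> verts G \<rightarrow> verts G"
    by (auto simp: graph_automorphisms_def dest: Bij_imp_funcset)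
  with fg have "u \<rightarrow>\<^bsub>G\<^esub> v \<longleftrightarrow> f (g u) \<rightarrow>\<^bsub>G\<^esub> f (g v)"
    if "u \<in> verts G" "v \<in> verts G" for u v
    using that unfolding graph_automorphisms_def by blast
  with B show "f \<otimes>\<^bsub>BijGroup (verts G)\<^esub> g \<in> graph_automorphisms G"
    by (simp add: graph_automorphisms_def BijGroup_def compose_Bij compose_eq)
qed

lemma group_action_automorphism_group:
  "group_action (automorphism_group G) (verts G) (\<lambda>f. f)"
proof -
  interpret B: group "BijGroup (verts G)" by (rule group_BijGroup)
  have "group_hom (automorphism_group G) (BijGroup (verts G)) id"
    unfolding automorphism_group_def
    by (rule B.canonical_inj_is_hom[OF subgroup_graph_automorphisms])
  then show ?thesis
    by (simp add: group_action_def id_def)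
qed

end

theory Submission
  imports Defs
begin

text \<open>
  Identify a vertex with its set of positions of 1s. The empty set is the only vertex of degree
  \<open>n\<close>, so an automorphism fixes it and hence preserves cardinalities and inclusions; it is
  therefore induced by a permutation of the singletons. Considering sets of size two, this
  permutation preserves adjacency in the path on \<open>n\<close> points, so it is the identity or the
  reflection. Hence the orbits are the sets \<open>{u, rev u}\<close>, and it remains to count Fibonacci
  strings and Fibonacci palindromes; stripping both ends off a palindrome gives the recursion
  \<open>p (n + 4) = p (n + 2) + p n\<close>.
\<close>

section \<open>Automorphisms in terms of sets of positions\<close>

text \<open>These are the independent sets of the path on the points \<open>0..n-1\<close>;
  \<open>ones\<close> below identifies them with the vertices of the Fibonacci cube.\<close>

definition sparse_sets :: "nat \<Rightarrow> nat set set" where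
  "sparse_sets n = {S. S \<subseteq> {..<n} \<and> (\<forall>i\<in>S. Suc i \<notin> S)}"

text \<open>Hypercube adjacency transported to sets of positions.\<close>

definition differ_once :: "'a set \<Rightarrow> 'a set \<Rightarrow> bool" where
  "differ_once S T \<longleftrightarrow> (\<exists>x. sym_diff S T = {x})"

lemma sparse_sets_subset: "S \<in> sparse_sets n \<Longrightarrow> T \<subseteq> S \<Longrightarrow> T \<in> sparse_sets n"
  unfolding sparse_sets_def by blast

lemma finite_sparse_set: "S \<in> sparse_sets n \<Longrightarrow> finite S"
  unfolding sparse_sets_def using finite_subset by blast

lemma finite_sparse_sets: "finite (sparse_sets n)"
  by (rule finite_subset[of _ "Pow {..<n}"]) (auto simp: sparse_sets_def)

lemma empty_in_sparse_sets [simp]: "{} \<in> sparse_sets n"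
  by (simp add: sparse_sets_def)

lemma singleton_in_sparse_sets [simp]: "{i} \<in> sparse_sets n \<longleftrightarrow> i < n"
  by (auto simp: sparse_sets_def)

lemma differ_once_cases:
  assumes "differ_once S T"
  obtains x where "x \<notin> S" "T = insert x S" | x where "x \<notin> T" "S = insert x T"
proof -
  obtain x where x: "sym_diff S T = {x}"
    using assms by (auto simp: differ_once_def)
  have mem: "y \<in> T \<longleftrightarrow> (y \<in> S) \<noteq> (y = x)" for y
    using x by (simp add: set_eq_iff) blast
  show thesis
  proof (cases "x \<in> S")
    case True
    then have "x \<notin> T" "S = insert x T" using mem by blast+
    then show thesis by (rule that(2))
  next
    case False
    moreover have "T = insert x S" using mem False by blast
    ultimately show thesis by (rule that(1))
  qed
qed

lemma differ_once_insert: "x \<notin> S \<Longrightarrow> differ_once S (insert x S)"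
  unfolding differ_once_def by (rule exI[of _ x]) blast

text \<open>If \<open>i\<close> lies in \<open>S\<close>, then a path neighbour \<open>j\<close> of
  \<open>i\<close> can neither be removed from \<open>S\<close> (it is not in it) nor added (the
  result would not be sparse). So all neighbours of \<open>S\<close> arise by toggling one of the
  other \<open>n - 1\<close> positions. This separates nonempty sets from the empty set, which has
  degree \<open>n\<close>.\<close>

lemma card_neighbours_nonempty:
  assumes "n \<ge> 2" "S \<in> sparse_sets n" "S \<noteq> {}"
  shows "card {T \<in> sparse_sets n. differ_once S T} < n"
proof -
  obtain i where i: "i \<in> S" "i < n"
    using assms(2,3) by (auto simp: sparse_sets_def)
  \<comment> \<open>Position 0 has no left neighbour; its right neighbour 1 is a legal position
    because \<open>n\<close> is at least 2.\<close>
  define j where "j = (if i = 0 then 1 else i - 1)"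
  have j: "j < n" "j = Suc i \<or> i = Suc j"
    using i assms(1) by (auto simp: j_def)
  have jS: "j \<notin> S"
    using j(2) i assms(2) by (auto simp: sparse_sets_def)
  have "{T \<in> sparse_sets n. differ_once S T} \<subseteq> (\<lambda>x. sym_diff S {x}) ` ({..<n} - {j})"
  proof
    fix T assume "T \<in> {T \<in> sparse_sets n. differ_once S T}"
    then have T: "T \<in> sparse_sets n" "differ_once S T" by auto
    then obtain x where x: "sym_diff S T = {x}" by (auto simp: differ_once_def)
    then have eq: "T = sym_diff S {x}" by blast
    have "x \<in> S \<or> x \<in> T" using x by blast
    then have "x < n" using T(1) assms(2) by (auto simp: sparse_sets_def)
    moreover have "x \<noteq> j"
    proof
      assume "x = j"
      then have "T = insert j S" using eq jS by auto
      then show False using T(1) i j(2) by (auto simp: sparse_sets_def)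
    qed
    ultimately show "T \<in> (\<lambda>x. sym_diff S {x}) ` ({..<n} - {j})" using eq by blast
  qed
  then have "card {T \<in> sparse_sets n. differ_once S T} \<le> card ({..<n} - {j})"
    by (rule surj_card_le[rotated]) simp
  then show ?thesis using j(1) by simp
qed

lemma card_neighbours_empty: "card {T \<in> sparse_sets n. differ_once {} T} = n"
proof -
  have "{T \<in> sparse_sets n. differ_once {} T} = (\<lambda>i. {i}) ` {..<n}"
    by (auto simp: differ_once_def)
  then show ?thesis by (simp add: card_image)
qed

text \<open>Build \<open>S\<close> from the empty set one element at a time: each step moves the
  image to a neighbour, so its cardinality grows by at most one. Only one direction of adjacency is
  assumed, so that the lemma applies to an automorphism and to its inverse alike.\<close>

lemma card_contracting:
  assumes "f {} = {}" "f ` sparse_sets n \<subseteq> sparse_sets n"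
    and "\<And>S T. \<lbrakk>S \<in> sparse_sets n; T \<in> sparse_sets n; differ_once S T\<rbrakk> \<Longrightarrow> differ_once (f S) (f T)"
    and "S \<in> sparse_sets n"
  shows "card (f S) \<le> card S"
  using finite_sparse_set[OF assms(4)] assms(4)
proof (induction S rule: finite_induct)
  case empty
  then show ?case using assms(1) by simp
next
  case (insert x S)
  have S: "S \<in> sparse_sets n" using insert.prems by (rule sparse_sets_subset) blast
  have fin: "finite (f S)" using S assms(2) finite_sparse_set by blast
  have "differ_once (f S) (f (insert x S))"
    using S insert by (intro assms(3) differ_once_insert)
  then have "card (f (insert x S)) \<le> Suc (card (f S))"
    by (cases rule: differ_once_cases) (use fin in auto)
  then show ?case using insert S by simp
qed

locale sparse_sets_automorphism =
  fixes n :: nat and f :: "nat set \<Rightarrow> nat set"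
  assumes n_ge_2: "n \<ge> 2"
    and bij: "bij_betw f (sparse_sets n) (sparse_sets n)"
    and differ_once_iff: "\<And>S T. \<lbrakk>S \<in> sparse_sets n; T \<in> sparse_sets n\<rbrakk>
      \<Longrightarrow> differ_once (f S) (f T) \<longleftrightarrow> differ_once S T"
begin

section \<open>Automorphisms preserve cardinality and inclusion\<close>

lemma inj: "inj_on f (sparse_sets n)"
  and image: "f ` sparse_sets n = sparse_sets n"
  using bij by (auto simp: bij_betw_def)

lemma closed: "S \<in> sparse_sets n \<Longrightarrow> f S \<in> sparse_sets n"
  using bij by (rule bij_betw_apply)

text \<open>\<open>f\<close> maps the \<open>n\<close> neighbours of the empty set injectively to
  neighbours of \<open>f {}\<close>, and a nonempty set has fewer than \<open>n\<close>
  neighbours.\<close>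

lemma fixes_empty: "f {} = {}"
proof (rule ccontr)
  assume ne: "f {} \<noteq> {}"
  let ?N = "\<lambda>S. {T \<in> sparse_sets n. differ_once S T}"
  have "card (?N {}) \<le> card (?N (f {}))"
  proof (rule card_inj_on_le)
    show "inj_on f (?N {})" using inj by (rule inj_on_subset) blast
    show "f ` ?N {} \<subseteq> ?N (f {})" using closed differ_once_iff by auto
    show "finite (?N (f {}))" using finite_sparse_sets by simp
  qed
  then show False
    using card_neighbours_empty card_neighbours_nonempty[OF n_ge_2 closed ne] by fastforce
qed

lemma card_preserved:
  assumes "S \<in> sparse_sets n"
  shows "card (f S) = card S"
proof (rule antisym)
  show "card (f S) \<le> card S"
    using assms fixes_empty image differ_once_iff by (intro card_contracting[of f n]) auto
  let ?g = "inv_into (sparse_sets n) f"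
  have gf: "?g (f T) = T" if "T \<in> sparse_sets n" for T
    using inj that by simp
  have fg: "f (?g T) = T" "?g T \<in> sparse_sets n" if "T \<in> sparse_sets n" for T
    using image that by (simp_all add: f_inv_into_f inv_into_into)
  \<comment> \<open>The inverse also fixes the empty set and preserves adjacency, which gives the
    opposite inequality.\<close>
  have "card (?g (f S)) \<le> card (f S)"
  proof (rule card_contracting[of ?g n])
    show "?g {} = {}" using gf[of "{}"] fixes_empty by simp
    show "?g ` sparse_sets n \<subseteq> sparse_sets n" using fg by blast
    show "differ_once (?g T) (?g U)"
      if "T \<in> sparse_sets n" "U \<in> sparse_sets n" "differ_once T U" for T U
      using that fg differ_once_iff[of "?g T" "?g U"] by simp
    show "f S \<in> sparse_sets n" using assms by (rule closed)
  qed
  then show "card S \<le> card (f S)" using gf assms by simp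
qed

text \<open>The two images are adjacent, so one arises from the other by adding an element;
  preservation of cardinality decides which one is larger.\<close>

lemma insert_mono:
  assumes "insert x S \<in> sparse_sets n" "x \<notin> S"
  shows "f S \<subseteq> f (insert x S)"
proof -
  have S: "S \<in> sparse_sets n" using assms(1) by (rule sparse_sets_subset) blast
  have fin: "finite S" "finite (f S)" "finite (f (insert x S))"
    using S assms closed finite_sparse_set by auto
  have less: "card (f S) < card (f (insert x S))"
    using card_preserved[OF S] card_preserved[OF assms(1)] fin assms(2) by simp
  have "differ_once (f S) (f (insert x S))"
    using differ_once_iff[OF S assms(1)] assms(2) by (simp add: differ_once_insert)
  then show ?thesis
    by (cases rule: differ_once_cases) (use fin less in auto)
qed

text \<open>Start from \<open>{i}\<close> and insert the remaining elements of \<open>S\<close>. All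
  intermediate sets are subsets of \<open>S\<close>, hence sparse, so \<open>insert_mono\<close>
  applies at each step.\<close>

lemma singleton_mono:
  assumes "S \<in> sparse_sets n" "i \<in> S"
  shows "f {i} \<subseteq> f S"
proof -
  have "f {i} \<subseteq> f (insert i T)" if "finite T" "insert i T \<in> sparse_sets n" "i \<notin> T" for T
    using that
  proof (induction T rule: finite_induct)
    case (insert x T)
    have "insert i T \<in> sparse_sets n" using insert.prems(1) by (rule sparse_sets_subset) blast
    then have "f {i} \<subseteq> f (insert i T)" using insert by blast
    also have "\<dots> \<subseteq> f (insert x (insert i T))"
      using insert by (intro insert_mono) (auto simp: insert_commute)
    finally show ?case by (simp add: insert_commute)
  qed simp
  from this[of "S - {i}"] show ?thesis
    using assms finite_sparse_set by (auto simp: insert_absorb)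
qed

section \<open>The induced permutation of positions\<close>

definition perm :: "nat \<Rightarrow> nat" where
  "perm i = the_elem (f {i})"

lemma singleton:
  assumes "i < n"
  shows "f {i} = {perm i}"
proof -
  have "card (f {i}) = 1" using card_preserved[of "{i}"] assms by simp
  then obtain x where "f {i} = {x}" by (rule card_1_singletonE)
  then show ?thesis by (simp add: perm_def)
qed

lemma perm_less: "i < n \<Longrightarrow> perm i < n"
  using closed[of "{i}"] singleton[of i] by simp

lemma inj_on_perm: "inj_on perm {..<n}"
proof (rule inj_onI)
  fix i j assume ij: "i \<in> {..<n}" "j \<in> {..<n}" "perm i = perm j"
  then have "f {i} = f {j}" using singleton by simp
  then have "{i} = {j}" by (rule inj_onD[OF inj]) (use ij in auto)
  then show "i = j" by simp
qed

text \<open>One inclusion is \<open>singleton_mono\<close>; equality follows since both sides have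
  as many elements as \<open>S\<close>.\<close>

lemma eq_image_perm:
  assumes "S \<in> sparse_sets n"
  shows "f S = perm ` S"
proof -
  have sub: "S \<subseteq> {..<n}" using assms by (simp add: sparse_sets_def)
  have "perm ` S \<subseteq> f S"
  proof
    fix j assume "j \<in> perm ` S"
    then obtain i where i: "i \<in> S" "j = perm i" by blast
    then have "f {i} = {j}" using sub singleton by blast
    with singleton_mono[OF assms i(1)] show "j \<in> f S" by blast
  qed
  moreover have "card (perm ` S) = card (f S)"
    using card_image[OF inj_on_subset[OF inj_on_perm sub]] card_preserved[OF assms] by simp
  ultimately show ?thesis
    using card_subset_eq closed[OF assms] finite_sparse_set by metis
qed

text \<open>Otherwise the images of \<open>i\<close> and \<open>Suc i\<close> would form a sparse
  set. By injectivity of \<open>perm\<close>, its preimage under \<open>f\<close> would be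
  \<open>{i, Suc i}\<close>, which is not sparse.\<close>

lemma perm_adjacent:
  assumes "Suc i < n"
  shows "perm (Suc i) = Suc (perm i) \<or> perm i = Suc (perm (Suc i))"
proof (rule ccontr)
  assume contra: "\<not> ?thesis"
  have "{perm i, perm (Suc i)} \<in> sparse_sets n"
    using contra perm_less[of i] perm_less[of "Suc i"] assms
    by (auto simp: sparse_sets_def)
  then obtain S where S: "S \<in> sparse_sets n" "f S = {perm i, perm (Suc i)}"
    using image by (metis imageE)
  have "perm ` S = perm ` {i, Suc i}" using S eq_image_perm by simp
  moreover have "S \<subseteq> {..<n}" "{i, Suc i} \<subseteq> {..<n}" using S assms by (auto simp: sparse_sets_def)
  ultimately have "S = {i, Suc i}" using inj_on_perm inj_on_image_eq_iff by metis
  then show False using S by (simp add: sparse_sets_def)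
qed

text \<open>The values of \<open>perm\<close> form a walk with unit steps that never revisits a
  point, so it cannot turn round and is linear with slope 1 or -1. The range \<open>{..<n}\<close>
  then forces its starting point.\<close>

lemma perm_cases: "(\<forall>i<n. perm i = i) \<or> (\<forall>i<n. perm i = n - 1 - i)"
proof -
  \<comment> \<open>Integers are used because the slope may be negative.\<close>
  define d where "d = int (perm 1) - int (perm 0)"
  have d: "d = 1 \<or> d = -1" using perm_adjacent[of 0] n_ge_2 by (auto simp: d_def)
  have step: "Suc i < n \<Longrightarrow> int (perm (Suc i)) = int (perm i) + d" for i
  proof (induction i)
    case (Suc i)
    \<comment> \<open>Injectivity rules out a step back, so the next step has the same sign as the
      previous one.\<close>
    have "perm (Suc (Suc i)) \<noteq> perm i"
      using Suc.prems inj_onD[OF inj_on_perm, of "Suc (Suc i)" i] by auto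
    then show ?case
      using Suc perm_adjacent[of i] perm_adjacent[of "Suc i"] d by auto
  qed (simp add: d_def)
  have lin: "i < n \<Longrightarrow> int (perm i) = int (perm 0) + int i * d" for i
    by (induction i) (auto simp: step algebra_simps)
  \<comment> \<open>The walk covers a distance of \<open>n - 1\<close>, so it must run from one end
    of the path to the other.\<close>
  have last: "int (perm (n - 1)) = int (perm 0) + int (n - 1) * d"
    using n_ge_2 by (intro lin) simp
  from d show ?thesis
  proof
    assume "d = 1"
    then have "perm 0 = 0" using last perm_less[of "n - 1"] n_ge_2 by simp
    then show ?thesis using lin \<open>d = 1\<close> by simp
  next
    assume "d = -1"
    then have "perm 0 = n - 1" using last perm_less[of 0] n_ge_2 by simp
    then have "perm i = n - 1 - i" if "i < n" for i
      using lin[OF that] \<open>d = -1\<close> that by simp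
    then show ?thesis by blast
  qed
qed

lemma id_or_reflection:
  "(\<forall>S\<in>sparse_sets n. f S = S) \<or> (\<forall>S\<in>sparse_sets n. f S = (\<lambda>i. n - 1 - i) ` S)"
  using perm_cases
proof
  assume *: "\<forall>i<n. perm i = i"
  have "f S = S" if "S \<in> sparse_sets n" for S
  proof -
    have "perm ` S = id ` S"
      using * that by (intro image_cong) (auto simp: sparse_sets_def)
    then show ?thesis using eq_image_perm[OF that] by simp
  qed
  then show ?thesis by blast
next
  assume *: "\<forall>i<n. perm i = n - 1 - i"
  have "f S = (\<lambda>i. n - 1 - i) ` S" if "S \<in> sparse_sets n" for S
  proof -
    have "perm ` S = (\<lambda>i. n - 1 - i) ` S"
      using * that by (intro image_cong) (auto simp: sparse_sets_def)
    then show ?thesis using eq_image_perm[OF that] by simp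
  qed
  then show ?thesis by blast
qed

end

section \<open>Orbits of the Fibonacci cube\<close>

definition fib_strings :: "nat \<Rightarrow> bool list set" where
  "fib_strings n = {u. length u = n \<and> fibonacci_string u}"

definition ones :: "bool list \<Rightarrow> nat set" where
  "ones u = {i. i < length u \<and> u ! i}"

lemma bij_betw_ones: "bij_betw ones (fib_strings n) (sparse_sets n)"
proof (rule bij_betw_byWitness[where f' = "\<lambda>S. map (\<lambda>i. i \<in> S) [0..<n]"])
  show "\<forall>u\<in>fib_strings n. map (\<lambda>i. i \<in> ones u) [0..<n] = u"
    by (auto simp: fib_strings_def ones_def intro: nth_equalityI)
  show "\<forall>S\<in>sparse_sets n. ones (map (\<lambda>i. i \<in> S) [0..<n]) = S"
    by (auto simp: sparse_sets_def ones_def)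
  show "ones ` fib_strings n \<subseteq> sparse_sets n"
    by (auto simp: sparse_sets_def ones_def fib_strings_def fibonacci_string_def)
  show "(\<lambda>S. map (\<lambda>i. i \<in> S) [0..<n]) ` sparse_sets n \<subseteq> fib_strings n"
    by (auto simp: sparse_sets_def fib_strings_def fibonacci_string_def)
qed

lemma ones_rev: "ones (rev u) = (\<lambda>i. length u - 1 - i) ` ones u"
proof (intro equalityI subsetI)
  fix i assume "i \<in> ones (rev u)"
  then have "i < length u" "length u - 1 - i \<in> ones u" "i = length u - 1 - (length u - 1 - i)"
    by (auto simp: ones_def rev_nth)
  then show "i \<in> (\<lambda>i. length u - 1 - i) ` ones u" by blast
next
  fix i assume "i \<in> (\<lambda>i. length u - 1 - i) ` ones u"
  then show "i \<in> ones (rev u)"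
    by (auto simp: ones_def rev_nth)
qed

lemma fibonacci_string_rev [simp]: "fibonacci_string (rev u) \<longleftrightarrow> fibonacci_string u"
proof -
  have "fibonacci_string (rev u)" if "fibonacci_string u" for u
    unfolding fibonacci_string_def
  proof (intro allI impI)
    fix i assume i: "Suc i < length (rev u)"
    \<comment> \<open>Positions \<open>i\<close> and \<open>Suc i\<close> of \<open>rev u\<close>
      are positions \<open>Suc ?j\<close> and \<open>?j\<close> of \<open>u\<close>.\<close>
    let ?j = "length u - Suc (Suc i)"
    have "\<not> (u ! ?j \<and> u ! Suc ?j)"
      using that i by (simp add: fibonacci_string_def)
    then show "\<not> (rev u ! i \<and> rev u ! Suc i)"
      using i by (auto simp: rev_nth Suc_diff_Suc)
  qed
  from this[of u] this[of "rev u"] show ?thesis by auto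
qed

lemma rev_in_fib_strings [simp]: "rev u \<in> fib_strings n \<longleftrightarrow> u \<in> fib_strings n"
  by (simp add: fib_strings_def)

lemma verts_fibonacci_cube: "verts (fibonacci_cube n) = fib_strings n"
  by (auto simp: fibonacci_cube_def hypercube_def induce_subgraph_def fib_strings_def)

text \<open>The symmetric difference of the two sets of ones is exactly the set of positions in
  which the strings differ.\<close>

lemma adjacent_fibonacci_cube:
  assumes "u \<in> fib_strings n" "v \<in> fib_strings n"
  shows "u \<rightarrow>\<^bsub>fibonacci_cube n\<^esub> v \<longleftrightarrow> differ_once (ones u) (ones v)"
proof -
  have "sym_diff (ones u) (ones v) = {i. i < n \<and> u ! i \<noteq> v ! i}"
    using assms by (auto simp: ones_def fib_strings_def)
  moreover have "u \<rightarrow>\<^bsub>fibonacci_cube n\<^esub> v \<longleftrightarrow> card {i. i < n \<and> u ! i \<noteq> v ! i} = 1"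
    using assms
    by (auto simp: fibonacci_cube_def hypercube_def induce_subgraph_def fib_strings_def
        arcs_ends_def arc_to_ends_def)
  ultimately show ?thesis
    by (simp add: differ_once_def card_1_singleton_iff)
qed

lemma graph_automorphism_id_or_rev:
  assumes n: "n \<ge> 2" and f: "f \<in> graph_automorphisms (fibonacci_cube n)"
  shows "(\<forall>u\<in>fib_strings n. f u = u) \<or> (\<forall>u\<in>fib_strings n. f u = rev u)"
proof -
  let ?str = "inv_into (fib_strings n) ones"
  \<comment> \<open>Conjugating \<open>f\<close> with the bijection \<open>ones\<close> yields an
    automorphism on sparse sets, to which \<open>id_or_reflection\<close> applies.\<close>
  define F where "F = (\<lambda>S. ones (f (?str S)))"
  have f_bij: "bij_betw f (fib_strings n) (fib_strings n)"
    and f_adj: "\<And>u v. \<lbrakk>u \<in> fib_strings n; v \<in> fib_strings n\<rbrakk> \<Longrightarrow>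
      u \<rightarrow>\<^bsub>fibonacci_cube n\<^esub> v \<longleftrightarrow> f u \<rightarrow>\<^bsub>fibonacci_cube n\<^esub> f v"
    using f by (auto simp: graph_automorphisms_def Bij_def verts_fibonacci_cube)
  have f_in: "f u \<in> fib_strings n" if "u \<in> fib_strings n" for u
    using f_bij that by (auto simp: bij_betw_def)
  have str_bij: "bij_betw ?str (sparse_sets n) (fib_strings n)"
    by (rule bij_betw_inv_into[OF bij_betw_ones])
  have str_in: "?str S \<in> fib_strings n" if "S \<in> sparse_sets n" for S
    using str_bij that by (auto simp: bij_betw_def)
  have ones_str: "ones (?str S) = S" if "S \<in> sparse_sets n" for S
    using bij_betw_inv_into_right[OF bij_betw_ones that] .
  interpret sparse_sets_automorphism n F
  proof
    show "n \<ge> 2" by (rule n)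
    show "bij_betw F (sparse_sets n) (sparse_sets n)"
      using bij_betw_trans[OF bij_betw_trans[OF str_bij f_bij] bij_betw_ones]
      by (simp add: F_def comp_def)
    show "differ_once (F S) (F T) \<longleftrightarrow> differ_once S T"
      if "S \<in> sparse_sets n" "T \<in> sparse_sets n" for S T
      using that f_adj[of "?str S" "?str T"] f_in str_in ones_str
      by (simp add: F_def adjacent_fibonacci_cube)
  qed
  have ones_in: "ones u \<in> sparse_sets n" and F_ones: "F (ones u) = ones (f u)"
    if "u \<in> fib_strings n" for u
    using that bij_betw_ones bij_betw_inv_into_left[OF bij_betw_ones that]
    by (auto simp: bij_betw_def F_def)
  have eqI: "u = v" if "ones u = ones v" "u \<in> fib_strings n" "v \<in> fib_strings n" for u v
    using inj_onD[OF bij_betw_imp_inj_on[OF bij_betw_ones] that] .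
  from id_or_reflection show ?thesis
  proof
    assume "\<forall>S\<in>sparse_sets n. F S = S"
    then have "\<forall>u\<in>fib_strings n. f u = u"
      using ones_in F_ones f_in by (metis eqI)
    then show ?thesis ..
  next
    assume refl: "\<forall>S\<in>sparse_sets n. F S = (\<lambda>i. n - 1 - i) ` S"
    have "f u = rev u" if u: "u \<in> fib_strings n" for u
    proof (rule eqI)
      have "length u = n" using u by (simp add: fib_strings_def)
      then show "ones (f u) = ones (rev u)"
        using refl ones_in[OF u] F_ones[OF u] by (simp add: ones_rev)
    qed (use u f_in in auto)
    then show ?thesis by blast
  qed
qed

text \<open>Reversal reflects the positions, and an injective map commutes with symmetric
  differences and keeps their size. The restriction makes the map extensional, as membership in
  \<open>Bij\<close> demands.\<close>

lemma restrict_rev_automorphism: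
  "restrict rev (fib_strings n) \<in> graph_automorphisms (fibonacci_cube n)"
proof -
  have "bij_betw rev (fib_strings n) (fib_strings n)"
    by (rule bij_betw_byWitness[where f' = rev]) (simp_all add: image_subset_iff)
  then have "bij_betw (restrict rev (fib_strings n)) (fib_strings n) (fib_strings n)"
    by (subst bij_betw_cong[of _ _ rev]) simp_all
  moreover have "differ_once (ones (rev u)) (ones (rev v)) \<longleftrightarrow> differ_once (ones u) (ones v)"
    if uv: "u \<in> fib_strings n" "v \<in> fib_strings n" for u v
  proof -
    let ?r = "\<lambda>i. n - 1 - i"
    have len: "length u = n" "length v = n" using uv by (auto simp: fib_strings_def)
    then have sub: "ones u \<subseteq> {..<n}" "ones v \<subseteq> {..<n}" by (auto simp: ones_def)
    have inj: "inj_on ?r {..<n}" by (auto simp: inj_on_def)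
    \<comment> \<open>Because subtraction truncates, the reflection is handled as an injection on
      \<open>{..<n}\<close> only; both sets of ones lie in there.\<close>
    have "?r ` (ones u - ones v) = ?r ` ones u - ?r ` ones v"
      "?r ` (ones v - ones u) = ?r ` ones v - ?r ` ones u"
      by (rule inj_on_image_set_diff[OF inj]; use sub in blast)+
    then have "sym_diff (ones (rev u)) (ones (rev v)) = ?r ` sym_diff (ones u) (ones v)"
      by (simp only: ones_rev len image_Un)
    moreover have "inj_on ?r (sym_diff (ones u) (ones v))"
      using inj by (rule inj_on_subset) (use sub in blast)
    ultimately have "card (sym_diff (ones (rev u)) (ones (rev v))) = card (sym_diff (ones u) (ones v))"
      by (simp only: card_image)
    then show ?thesis by (simp add: differ_once_def flip: card_1_singleton_iff One_nat_def)
  qed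
  ultimately show ?thesis
    by (simp add: graph_automorphisms_def Bij_def verts_fibonacci_cube adjacent_fibonacci_cube)
qed

lemma vertex_orbits_fibonacci_cube:
  assumes "n \<ge> 2"
  shows "vertex_orbits (fibonacci_cube n) = (\<lambda>u. {u, rev u}) ` fib_strings n"
proof -
  have "orbit (automorphism_group (fibonacci_cube n)) (\<lambda>f. f) u = {u, rev u}"
    if u: "u \<in> fib_strings n" for u
  proof -
    \<comment> \<open>The identity and reversal show that \<open>u\<close> and \<open>rev u\<close>
      both lie in the orbit; the classification of automorphisms shows that nothing else
      does.\<close>
    have "restrict id (fib_strings n) \<in> graph_automorphisms (fibonacci_cube n)"
      by (auto simp: graph_automorphisms_def verts_fibonacci_cube id_def id_Bij)
    moreover note restrict_rev_automorphism[of n]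
    moreover have "u = restrict id (fib_strings n) u" "rev u = restrict rev (fib_strings n) u"
      using u by simp_all
    ultimately have "{u, rev u} \<subseteq> {g u |g. g \<in> graph_automorphisms (fibonacci_cube n)}"
      by blast
    moreover have "{g u |g. g \<in> graph_automorphisms (fibonacci_cube n)} \<subseteq> {u, rev u}"
      using graph_automorphism_id_or_rev[OF assms] u by blast
    ultimately show ?thesis
      by (auto simp: orbit_def automorphism_group_def)
  qed
  then show ?thesis
    by (auto simp: vertex_orbits_def orbits_def verts_fibonacci_cube)
qed

section \<open>Counting\<close>

lemma fibonacci_string_Nil [simp]: "fibonacci_string []"
  and fibonacci_string_single [simp]: "fibonacci_string [a]"
  by (simp_all add: fibonacci_string_def)

lemma fibonacci_string_Cons_Cons [simp]:
  "fibonacci_string (a # b # u) \<longleftrightarrow> \<not> (a \<and> b) \<and> fibonacci_string (b # u)"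
proof -
  \<comment> \<open>Position 0 yields the condition on \<open>a\<close> and \<open>b\<close>; the
    later positions yield the condition on the tail.\<close>
  have "(\<forall>i. P i) \<longleftrightarrow> P 0 \<and> (\<forall>i. P (Suc i))" for P :: "nat \<Rightarrow> bool"
    by (metis not0_implies_Suc)
  then show ?thesis
    unfolding fibonacci_string_def by (rule trans) simp
qed

lemma fibonacci_string_False_Cons [simp]:
  "fibonacci_string (False # u) \<longleftrightarrow> fibonacci_string u"
  by (cases u) auto

text \<open>Reversal moves the end of the string to the front, where the rules for \<open>#\<close>
  apply. This rule and the next serve to strip the right ends of palindromes.\<close>

lemma fibonacci_string_append_False [simp]:
  "fibonacci_string (u @ [False]) \<longleftrightarrow> fibonacci_string u"
proof -
  have "fibonacci_string (u @ [False]) \<longleftrightarrow> fibonacci_string (False # rev u)"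
    using fibonacci_string_rev[of "False # rev u"] by (simp only: rev.simps rev_rev_ident)
  then show ?thesis by (simp only: fibonacci_string_False_Cons fibonacci_string_rev)
qed

lemma fibonacci_string_append_False_True [simp]:
  "fibonacci_string (u @ [False, True]) \<longleftrightarrow> fibonacci_string u"
proof -
  have "fibonacci_string (u @ [False, True]) \<longleftrightarrow> fibonacci_string (True # False # rev u)"
    using fibonacci_string_rev[of "True # False # rev u"]
    by (simp only: rev.simps rev_rev_ident append_assoc append.simps)
  then show ?thesis by simp
qed

lemma finite_fib_strings [simp]: "finite (fib_strings n)"
proof (rule finite_subset)
  show "fib_strings n \<subseteq> {u. set u \<subseteq> UNIV \<and> length u = n}"
    by (auto simp: fib_strings_def)
  show "finite {u :: bool list. set u \<subseteq> UNIV \<and> length u = n}"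
    by (rule finite_lists_length_eq) simp
qed

text \<open>A Fibonacci string of length at least 2 starts either with 0 or with 10, followed by an
  arbitrary Fibonacci string; this is the Fibonacci recursion.\<close>

lemma card_fib_strings: "card (fib_strings n) = fib (n + 2)"
proof (induction n rule: fib.induct)
  case 1
  have "fib_strings 0 = {[]}" by (auto simp: fib_strings_def)
  then show ?case by simp
next
  case 2
  have "fib_strings (Suc 0) = {[False], [True]}"
    by (auto simp: fib_strings_def length_Suc_conv)
  then show ?case by simp
next
  case (3 n)
  have "fib_strings (Suc (Suc n)) =
      (#) False ` fib_strings (Suc n) \<union> (\<lambda>u. True # False # u) ` fib_strings n" (is "_ = ?A \<union> ?B")
  proof (intro equalityI subsetI)
    fix u assume u: "u \<in> fib_strings (Suc (Suc n))"
    then obtain a b v where v: "u = a # b # v" "length v = n"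
      by (auto simp: fib_strings_def length_Suc_conv)
    show "u \<in> ?A \<union> ?B"
    proof (cases a)
      case True
      then have "v \<in> fib_strings n" "u = True # False # v"
        using u v by (cases b; simp add: fib_strings_def)+
      then show ?thesis by blast
    next
      case False
      then have "b # v \<in> fib_strings (Suc n)" "u = False # b # v"
        using u v by (simp_all add: fib_strings_def)
      then show ?thesis by blast
    qed
  qed (auto simp: fib_strings_def)
  also have "card \<dots> = card (fib_strings (Suc n)) + card (fib_strings n)"
    by (subst card_Un_disjoint) (auto simp: card_image inj_on_def)
  finally show ?case using 3 by simp
qed

section \<open>Fibonacci palindromes\<close>

definition fib_palindromes :: "nat \<Rightarrow> bool list set" where
  "fib_palindromes n = {u \<in> fib_strings n. rev u = u}"

lemma finite_fib_palindromes [simp]: "finite (fib_palindromes n)"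
  by (simp add: fib_palindromes_def)

lemma palindrome_cases:
  assumes "rev u = u" "length u \<ge> 2"
  obtains a v where "u = a # v @ [a]" "rev v = v"
proof -
  obtain a w where w: "u = a # w" using assms(2) by (cases u) auto
  then obtain v b where v: "w = v @ [b]" using assms(2) by (cases w rule: rev_cases) auto
  have "b # rev v @ [a] = a # v @ [b]"
    using assms(1) unfolding w v rev.simps rev_append append.simps append_assoc .
  then have "b = a" "rev v = v" by (metis list.inject append1_eq_conv)+
  then have "u = a # v @ [a]" unfolding w v by simp
  then show thesis using \<open>rev v = v\<close> by (rule that)
qed

text \<open>Outer letters 0 put no constraint on the inner palindrome. Outer letters 1 force the
  letters next to them to be 0 on both sides, and length at least 4 makes these four positions
  distinct.\<close>

lemma fib_palindromes_add_4:
  "fib_palindromes (n + 4) = (\<lambda>v. False # v @ [False]) ` fib_palindromes (n + 2)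
     \<union> (\<lambda>v. True # False # v @ [False, True]) ` fib_palindromes n" (is "_ = ?A \<union> ?B")
proof (intro equalityI subsetI)
  fix u assume u: "u \<in> fib_palindromes (n + 4)"
  then have u': "rev u = u" "length u = n + 4" "fibonacci_string u"
    by (auto simp: fib_palindromes_def fib_strings_def)
  have "length u \<ge> 2" using u'(2) by simp
  with u'(1) obtain a v where v: "u = a # v @ [a]" "rev v = v"
    by (rule palindrome_cases)
  show "u \<in> ?A \<union> ?B"
  proof (cases a)
    case False
    then have "v \<in> fib_palindromes (n + 2)"
      using u' v by (auto simp: fib_palindromes_def fib_strings_def)
    then show ?thesis using v False by auto
  next
    case True
    have "length v \<ge> 2" using u'(2) v(1) by simp
    with v(2) obtain b w where w: "v = b # w @ [b]" "rev w = w"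
      by (rule palindrome_cases)
    have "\<not> b" using u' v w True by simp
    then have "w \<in> fib_palindromes n" "u = True # False # w @ [False, True]"
      using u' v w True by (auto simp: fib_palindromes_def fib_strings_def)
    then show ?thesis by blast
  qed
next
  fix u assume "u \<in> ?A \<union> ?B"
  then show "u \<in> fib_palindromes (n + 4)"
    by (auto simp: fib_palindromes_def fib_strings_def)
qed

lemma card_fib_palindromes_add_4:
  "card (fib_palindromes (n + 4)) = card (fib_palindromes (n + 2)) + card (fib_palindromes n)"
proof -
  have "inj_on (\<lambda>v. False # v @ [False]) (fib_palindromes (n + 2))"
    "inj_on (\<lambda>v. True # False # v @ [False, True]) (fib_palindromes n)"
    by (simp_all add: inj_on_def)
  then show ?thesis
    unfolding fib_palindromes_add_4 by (subst card_Un_disjoint) (auto simp: card_image)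
qed

text \<open>The recursion links lengths of equal parity only, so each parity needs two initial
  values.\<close>

lemma card_fib_palindromes_small:
  "card (fib_palindromes 0) = 1" "card (fib_palindromes 1) = 2"
  "card (fib_palindromes 2) = 1" "card (fib_palindromes 3) = 3"
proof -
  have "fib_palindromes 0 = {[]}"
    by (auto simp: fib_palindromes_def fib_strings_def)
  then show "card (fib_palindromes 0) = 1" by simp
  have "fib_palindromes 1 = {[False], [True]}"
    by (auto simp: fib_palindromes_def fib_strings_def length_Suc_conv)
  then show "card (fib_palindromes 1) = 2" by simp
  have "fib_palindromes 2 = {[False, False]}"
    by (auto simp: fib_palindromes_def fib_strings_def length_Suc_conv numeral_2_eq_2)
  then show "card (fib_palindromes 2) = 1" by simp
  have "fib_palindromes 3 = {[False, False, False], [False, True, False], [True, False, True]}"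
    by (auto simp: fib_palindromes_def fib_strings_def length_Suc_conv numeral_3_eq_3)
  then show "card (fib_palindromes 3) = 3" by simp
qed

text \<open>In terms of \<open>k\<close> the recursion is that of \<open>fib\<close>, started at 1,
  1; for odd lengths it starts at 2, 3, which shifts the index by two more.\<close>

lemma card_fib_palindromes_even: "card (fib_palindromes (2 * k)) = fib (k + 1)"
proof (induction k rule: fib.induct)
  case 1
  show ?case using card_fib_palindromes_small(1) by simp
next
  case 2
  show ?case using card_fib_palindromes_small(3) by simp
next
  case (3 k)
  then show ?case using card_fib_palindromes_add_4[of "2 * k"] by (simp add: numeral_eq_Suc)
qed

lemma card_fib_palindromes_odd: "card (fib_palindromes (2 * k + 1)) = fib (k + 3)"
proof (induction k rule: fib.induct)
  case 1
  have "fib (0 + 3) = 2" by (simp add: numeral_eq_Suc)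
  then show ?case using card_fib_palindromes_small(2) by simp
next
  case 2
  have "fib (Suc 0 + 3) = 3" by (simp add: numeral_eq_Suc)
  then show ?case using card_fib_palindromes_small(4) by simp
next
  case (3 k)
  then show ?case using card_fib_palindromes_add_4[of "2 * k + 1"] by (simp add: numeral_eq_Suc)
qed

lemma card_fib_palindromes:
  assumes "n \<ge> 2"
  shows "card (fib_palindromes n) = fib (nat \<lfloor>(real n - (-1) ^ n) / 2\<rfloor> + 2)"
proof (cases "even n")
  case True
  then obtain k where k: "n = 2 * k" by blast
  then have "\<lfloor>(real n - (-1) ^ n) / 2\<rfloor> = int k - 1"
    by (intro floor_unique) simp_all
  \<comment> \<open>Here \<open>n >= 2\<close> gives \<open>k >= 1\<close>, so \<open>nat\<close>
    does not cut off a negative value.\<close>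
  moreover have "nat (int k - 1) + 2 = k + 1" using assms k by simp
  ultimately show ?thesis using card_fib_palindromes_even[of k] k by simp
next
  case False
  then obtain k where k: "n = 2 * k + 1" by (rule oddE)
  then have "\<lfloor>(real n - (-1) ^ n) / 2\<rfloor> = int k + 1"
    by (intro floor_unique) simp_all
  moreover have "nat (int k + 1) + 2 = k + 3" by simp
  ultimately show ?thesis using card_fib_palindromes_odd[of k] k by (simp only:)
qed

section \<open>From counts of strings to counts of orbits\<close>

theorem theorem4p2:
  fixes n :: nat
  assumes "n \<ge> 2"
  shows "num_vertex_orbits_of_size (fibonacci_cube n) 1
           = fib (nat \<lfloor>(real n - (-1) ^ n) / 2\<rfloor> + 2) \<and>
         real (num_vertex_orbits_of_size (fibonacci_cube n) 2)
           = 1 / 2 * (real (fib (n + 2)) - real (fib (nat \<lfloor>(real n - (-1) ^ n) / 2\<rfloor> + 2))) \<and>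
         real (num_vertex_orbits (fibonacci_cube n))
           = 1 / 2 * (real (fib (n + 2)) + real (fib (nat \<lfloor>(real n - (-1) ^ n) / 2\<rfloor> + 2)))"
proof -
  let ?V = "fib_strings n" and ?P = "fib_palindromes n"
  define O1 where "O1 = {X \<in> vertex_orbits (fibonacci_cube n). card X = 1}"
  define O2 where "O2 = {X \<in> vertex_orbits (fibonacci_cube n). card X = 2}"
  have orbits: "vertex_orbits (fibonacci_cube n) = (\<lambda>u. {u, rev u}) ` ?V"
    using assms by (rule vertex_orbits_fibonacci_cube)
  have card_orbit: "card {u, rev u} = (if rev u = u then 1 else 2)" for u :: "bool list"
    by (cases "rev u = u") auto
  have fin: "finite (vertex_orbits (fibonacci_cube n))"
    unfolding orbits by simp
  have split: "vertex_orbits (fibonacci_cube n) = O1 \<union> O2" "O1 \<inter> O2 = {}"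
    unfolding O1_def O2_def orbits by (auto simp: card_orbit split: if_splits)
  have fin12: "finite O1" "finite O2"
    using fin unfolding split(1) by simp_all
  \<comment> \<open>An orbit \<open>{u, rev u}\<close> is a singleton exactly when \<open>u\<close>
    is a palindrome.\<close>
  have "O1 = (\<lambda>u. {u}) ` ?P"
    unfolding O1_def orbits fib_palindromes_def
    by (force simp: card_orbit split: if_splits)
  then have O1: "card O1 = card ?P"
    by (simp add: card_image)
  \<comment> \<open>The orbits partition the vertices, so the number of vertices is
    \<open>card O1 + 2 * card O2\<close>. With \<open>card O1\<close> known from the palindromes,
    this determines \<open>card O2\<close> and the total.\<close>
  have "\<Union> (vertex_orbits (fibonacci_cube n)) = ?V"
    unfolding orbits by auto
  moreover have "card (\<Union> (vertex_orbits (fibonacci_cube n))) = sum card (vertex_orbits (fibonacci_cube n))"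
    by (rule card_Union_disjoint) (auto simp: orbits pairwise_def disjnt_def)
  ultimately have "card ?V = sum card O1 + sum card O2"
    using fin12 split by (simp add: sum.union_disjoint)
  also have "\<dots> = card O1 + 2 * card O2"
    by (simp add: O1_def O2_def)
  finally have "fib (n + 2) = card O1 + 2 * card O2"
    by (simp only: card_fib_strings)
  moreover have "num_vertex_orbits (fibonacci_cube n) = card O1 + card O2"
    using fin12 split by (simp add: num_vertex_orbits_def card_Un_disjoint)
  moreover have "card O1 = fib (nat \<lfloor>(real n - (-1) ^ n) / 2\<rfloor> + 2)"
    using O1 card_fib_palindromes[OF assms] by simp
  ultimately show ?thesis
    unfolding num_vertex_orbits_of_size_def O1_def[symmetric] O2_def[symmetric]
    by (simp add: field_simps del: fib.simps)
qed

end
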